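(* Let $n\geq 1$ and let $m_1,\ldots,m_n$ be integers with $m_{i}\geq 3$ for all $i\in \{1,\ldots,n\}$. If $G=P_{m_1}\,\square\,P_{m_2}\,\square\cdots\square\,P_{m_n}$, then $\chi_{2}^{f}(G)=\big\lceil\frac{\Delta(G)}{2}\big\rceil+1$.
   Context: $P_m$ denotes the path on $m$ vertices and $\Delta(G)$ the maximum degree of $G$. The Cartesian product $G\,\square\, H$ has vertex set $V(G)\times V(H)$, two vertices being adjacent if they are adjacent in one coordinate and equal in the other. A $2$-frugal coloring of a graph is a proper vertex coloring in which no color appears more than twice in the (open) neighborhood of any vertex; $\chi_2^f(G)$ is the minimum number of colors in a $2$-frugal coloring of $G$. *)

theory Defs
  imports Complex_Main "Graph_Theory.Graph_Theory"
begin

text \<open>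
  A finite simple graph is a \<^typ>\<open>'a pair_pre_digraph\<close> satisfying \<^locale>\<open>pair_graph\<close>: an edge
  \<open>uv\<close> is represented by the two opposite arcs \<open>(u, v)\<close> and \<open>(v, u)\<close>.
\<close>

definition neighborhood :: "'a pair_pre_digraph \<Rightarrow> 'a \<Rightarrow> 'a set" where
  "neighborhood G v = {u. (v, u) \<in> parcs G}"

text \<open>
  As every edge is a pair of opposite arcs, the degree of a vertex is its out-degree
  (and not the sum of its in- and out-degrees); see \<open>out_degree_eq_card_neighborhood\<close>.
\<close>

definition max_degree :: "'a pair_pre_digraph \<Rightarrow> nat" where
  "max_degree G = Max (out_degree (with_proj G) ` pverts G)"

lemma out_degree_eq_card_neighborhood:
  "out_degree (with_proj G) v = card (neighborhood G v)"
proof -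
  have "out_arcs (with_proj G) v = Pair v ` neighborhood G v"
    by (auto simp: out_arcs_def neighborhood_def)
  then show ?thesis
    by (simp add: out_degree_def card_image inj_on_def)
qed

definition path_graph :: "nat \<Rightarrow> nat pair_pre_digraph" where
  "path_graph m =
     \<lparr>pverts = {..<m}, parcs = {(i, j). i < m \<and> j < m \<and> (j = Suc i \<or> i = Suc j)}\<rparr>"

definition cart_prod ::
  "'a pair_pre_digraph \<Rightarrow> 'b pair_pre_digraph \<Rightarrow> ('a \<times> 'b) pair_pre_digraph" where
  "cart_prod G H =
     \<lparr>pverts = pverts G \<times> pverts H,
      parcs = {((a, b), (a', b')).
         (a, b) \<in> pverts G \<times> pverts H \<and> (a', b') \<in> pverts G \<times> pverts H \<and>
         ((a, a') \<in> parcs G \<and> b = b' \<or> a = a' \<and> (b, b') \<in> parcs H)}\<rparr>"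

definition relabel :: "('a \<Rightarrow> 'b) \<Rightarrow> 'a pair_pre_digraph \<Rightarrow> 'b pair_pre_digraph" where
  "relabel f G = \<lparr>pverts = f ` pverts G, parcs = map_prod f f ` parcs G\<rparr>"

text \<open>
  The iterated product \<open>G\<^sub>1 \<box> (G\<^sub>2 \<box> \<dots>)\<close>. Nested pairs are flattened to lists, so that all products
  of graphs on one vertex type share a vertex type. The empty product is the one-vertex graph,
  the neutral element of \<open>\<box>\<close> up to isomorphism.
\<close>

fun cart_prod_list :: "'a pair_pre_digraph list \<Rightarrow> 'a list pair_pre_digraph" where
  "cart_prod_list [] = \<lparr>pverts = {[]}, parcs = {}\<rparr>"
| "cart_prod_list (G # Gs) = relabel (\<lambda>(x, xs). x # xs) (cart_prod G (cart_prod_list Gs))"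

definition frugal_coloring :: "nat \<Rightarrow> 'a pair_pre_digraph \<Rightarrow> ('a \<Rightarrow> 'c) \<Rightarrow> bool" where
  "frugal_coloring t G c \<longleftrightarrow>
     (\<forall>(u, v) \<in> parcs G. c u \<noteq> c v) \<and>
     (\<forall>v \<in> pverts G. \<forall>a. card {u \<in> neighborhood G v. c u = a} \<le> t)"

text \<open>
  On a finite simple graph the minimum is over a nonempty set when \<open>t \<ge> 1\<close>; see
  \<open>frugal_coloring_exists\<close>.
\<close>

definition frugal_chromatic_number :: "nat \<Rightarrow> 'a pair_pre_digraph \<Rightarrow> nat" where
  "frugal_chromatic_number t G =
     (LEAST k. \<exists>c :: 'a \<Rightarrow> nat. frugal_coloring t G c \<and> c ` pverts G \<subseteq> {..<k})"

lemma frugal_coloring_exists: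
  assumes "pair_graph G" and "t \<ge> 1"
  shows "\<exists>k. \<exists>c :: 'a \<Rightarrow> nat. frugal_coloring t G c \<and> c ` pverts G \<subseteq> {..<k}"
proof -
  interpret pair_graph G by fact
  obtain c :: "'a \<Rightarrow> nat" and k where c: "c ` pverts G = {i. i < k}" "inj_on c (pverts G)"
    using finite_imp_inj_to_nat_seg[OF pair_finite_verts] by blast
  have "card {u \<in> neighborhood G v. c u = a} \<le> 1" for v a
  proof -
    have "\<forall>x \<in> {u \<in> neighborhood G v. c u = a}. \<forall>y \<in> {u \<in> neighborhood G v. c u = a}. x = y"
      using c(2) by (auto simp: neighborhood_def dest: in_arcsD2 intro: inj_onD)
    then show ?thesis
      by (metis (no_types, lifting) card_le_Suc0_iff_eq One_nat_def card.infinite zero_le)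
  qed
  moreover have "c u \<noteq> c v" if "(u, v) \<in> parcs G" for u v
    using that c(2) in_arcsD1 in_arcsD2 pair_no_loops[OF that] by (auto dest: inj_onD)
  ultimately have "frugal_coloring t G c"
    using assms(2) le_trans unfolding frugal_coloring_def by blast
  then show ?thesis using c(1) by (auto simp: lessThan_def)
qed

lemma pair_graph_path_graph: "pair_graph (path_graph m)"
proof -
  have "parcs (path_graph m) \<subseteq> {..<m} \<times> {..<m}" by (auto simp: path_graph_def)
  then have "finite (parcs (path_graph m))" by (rule finite_subset) simp
  then show ?thesis
    by unfold_locales (auto simp: path_graph_def symmetric_def sym_def)
qed

lemma pverts_cart_prod_list:
  "pverts (cart_prod_list Gs) =
     {xs. length xs = length Gs \<and> (\<forall>i < length Gs. xs ! i \<in> pverts (Gs ! i))}"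
proof (induction Gs)
  case (Cons G Gs)
  have "xs \<in> pverts (cart_prod_list (G # Gs)) \<longleftrightarrow>
      length xs = length (G # Gs) \<and> (\<forall>i < length (G # Gs). xs ! i \<in> pverts ((G # Gs) ! i))" for xs
  proof (cases xs)
    case (Cons x xs')
    have "xs \<in> pverts (cart_prod_list (G # Gs)) \<longleftrightarrow>
        x \<in> pverts G \<and> xs' \<in> pverts (cart_prod_list Gs)"
      unfolding Cons by (force simp: relabel_def cart_prod_def)
    then show ?thesis
      unfolding Cons Cons.IH by (simp add: All_less_Suc2) blast
  qed (auto simp: relabel_def)
  then show ?case by blast
qed auto

lemma parcs_cart_prod_list:
  "parcs (cart_prod_list Gs) =
     {(xs, ys). xs \<in> pverts (cart_prod_list Gs) \<and> ys \<in> pverts (cart_prod_list Gs) \<and>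
        (\<exists>i < length Gs. (xs ! i, ys ! i) \<in> parcs (Gs ! i) \<and>
           (\<forall>j < length Gs. j \<noteq> i \<longrightarrow> xs ! j = ys ! j))}"
proof (induction Gs)
  case (Cons G Gs)
  let ?V = "pverts (cart_prod_list Gs)"
  have V: "xs = ys \<longleftrightarrow> (\<forall>j < length Gs. xs ! j = ys ! j)" if "xs \<in> ?V" "ys \<in> ?V" for xs ys
    using that by (auto simp: pverts_cart_prod_list intro: nth_equalityI)
  have P: "zs \<in> pverts (cart_prod_list (G # Gs)) \<longleftrightarrow>
      (\<exists>z zs'. zs = z # zs' \<and> z \<in> pverts G \<and> zs' \<in> ?V)" for zs
    by (auto simp: relabel_def cart_prod_def)
  have A: "(xs, ys) \<in> parcs (cart_prod_list (G # Gs)) \<longleftrightarrow>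
      (\<exists>x xs' y ys'. xs = x # xs' \<and> ys = y # ys' \<and> x \<in> pverts G \<and> y \<in> pverts G \<and>
         xs' \<in> ?V \<and> ys' \<in> ?V \<and>
         ((x, y) \<in> parcs G \<and> xs' = ys' \<or> x = y \<and> (xs', ys') \<in> parcs (cart_prod_list Gs)))"
    for xs ys
    by (force simp: relabel_def cart_prod_def image_iff)
  have B: "(x # xs, y # ys) \<in> parcs (cart_prod_list (G # Gs)) \<longleftrightarrow>
      (\<exists>i < length (G # Gs). ((x # xs) ! i, (y # ys) ! i) \<in> parcs ((G # Gs) ! i) \<and>
         (\<forall>j < length (G # Gs). j \<noteq> i \<longrightarrow> (x # xs) ! j = (y # ys) ! j))"
    if "x \<in> pverts G" "y \<in> pverts G" "xs \<in> ?V" "ys \<in> ?V" for x xs y ys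
    unfolding A using that V[OF that(3,4)]
    by (simp add: Cons.IH Ex_less_Suc2 All_less_Suc2) blast
  have "(xs, ys) \<in> parcs (cart_prod_list (G # Gs)) \<longleftrightarrow>
      xs \<in> pverts (cart_prod_list (G # Gs)) \<and> ys \<in> pverts (cart_prod_list (G # Gs)) \<and>
      (\<exists>i < length (G # Gs). (xs ! i, ys ! i) \<in> parcs ((G # Gs) ! i) \<and>
         (\<forall>j < length (G # Gs). j \<noteq> i \<longrightarrow> xs ! j = ys ! j))" (is "?L \<longleftrightarrow> ?R") for xs ys
  proof
    assume L: ?L
    then obtain x xs' y ys' where *: "xs = x # xs'" "ys = y # ys'"
      "x \<in> pverts G" "y \<in> pverts G" "xs' \<in> ?V" "ys' \<in> ?V"
      unfolding A by blast
    show ?R using L B[OF *(3-6)] P *(3-6) unfolding *(1,2) by blast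
  next
    assume R: ?R
    then obtain x xs' y ys' where *: "xs = x # xs'" "ys = y # ys'"
      "x \<in> pverts G" "y \<in> pverts G" "xs' \<in> ?V" "ys' \<in> ?V"
      unfolding P by blast
    show ?L using R B[OF *(3-6)] unfolding *(1,2) by blast
  qed
  then show ?case by blast
qed auto

lemma pair_graph_cart_prod_list:
  assumes "\<And>G. G \<in> set Gs \<Longrightarrow> pair_graph G"
  shows "pair_graph (cart_prod_list Gs)"
proof -
  have fin: "finite (pverts (cart_prod_list Gs))"
    using assms
  proof (induction Gs)
    case (Cons G Gs)
    interpret pair_graph G by (rule Cons.prems) simp
    have "finite (pverts (cart_prod_list Gs))" using Cons by simp
    then show ?case using pair_finite_verts by (simp add: relabel_def cart_prod_def)
  qed simp
  have sub: "parcs (cart_prod_list Gs) \<subseteq> pverts (cart_prod_list Gs) \<times> pverts (cart_prod_list Gs)"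
    unfolding parcs_cart_prod_list by auto
  have fin': "finite (parcs (cart_prod_list Gs))"
    by (rule finite_subset[OF sub]) (simp add: fin)
  have g: "pair_graph (Gs ! i)" if "i < length Gs" for i
    using that assms by simp
  have s: "(y, x) \<in> parcs (Gs ! i)" if "i < length Gs" "(x, y) \<in> parcs (Gs ! i)" for i x y
  proof -
    interpret pair_graph "Gs ! i" by (rule g[OF that(1)])
    show ?thesis using that(2) pair_sym_arcs by (simp add: symmetric_def sym_def)
  qed
  have l: "(x, x) \<notin> parcs (Gs ! i)" if "i < length Gs" for i x
  proof -
    interpret pair_graph "Gs ! i" by (rule g[OF that])
    show ?thesis using pair_no_loops[of "(x, x)"] by auto
  qed
  have "sym (parcs (cart_prod_list Gs))"
  proof (rule symI)
    fix xs ys assume "(xs, ys) \<in> parcs (cart_prod_list Gs)"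
    then obtain i where "xs \<in> pverts (cart_prod_list Gs)" "ys \<in> pverts (cart_prod_list Gs)"
      "i < length Gs" "(xs ! i, ys ! i) \<in> parcs (Gs ! i)"
      "\<forall>j < length Gs. j \<noteq> i \<longrightarrow> xs ! j = ys ! j"
      unfolding parcs_cart_prod_list by blast
    moreover from this have "(ys ! i, xs ! i) \<in> parcs (Gs ! i)" by (blast intro: s)
    ultimately show "(ys, xs) \<in> parcs (cart_prod_list Gs)"
      unfolding parcs_cart_prod_list by auto
  qed
  moreover have "(xs, xs) \<notin> parcs (cart_prod_list Gs)" for xs
    unfolding parcs_cart_prod_list using l by auto
  ultimately show ?thesis
    using fin fin' sub by unfold_locales (auto simp: symmetric_def)
qed

end

theory Submission
  imports Defs "HOL-Number_Theory.Cong"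
begin

text \<open>
  A grid of dimension \<open>n\<close> whose sides all have at least three vertices has an interior vertex, and
  that vertex has \<open>2 n\<close> neighbors. Its own color is unavailable to them, and each other color
  serves at most two, so at least \<open>n + 1\<close> colors are needed (\<open>frugal_coloring_degree_le\<close>).

  Conversely, color the vertex \<open>x\<close> by \<open>\<Sum> (i + 1) x\<^sub>i\<close> modulo \<open>n + 1\<close>, the sum being over
  \<open>i < n\<close>. A step along the axis \<open>i\<close> changes the color by \<open>\<plusminus>(i + 1)\<close>. The numbers
  \<open>1, \<dots>, n\<close> are pairwise incongruent and nonzero modulo \<open>n + 1\<close>. Hence adjacent vertices get
  different colors, the upward neighbors of a vertex get pairwise different colors, and so do its
  downward neighbors: a color occurs at most once among the former and at most once among the
  latter (\<open>frugal_coloring_grid_color\<close>).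

  The existence of this coloring also gives the upper bound \<open>\<Delta> \<le> 2 n\<close>, again by
  \<open>frugal_coloring_degree_le\<close>; so \<open>\<Delta> = 2 n\<close>, and both sides of the formula equal \<open>n + 1\<close>.
\<close>

section \<open>Degrees in frugally colored graphs\<close>

text \<open>
  The neighbors of \<open>v\<close> share the \<open>k - 1\<close> colors other than that of \<open>v\<close>, each used at most \<open>t\<close>
  times among them. So a vertex of large degree forces many colors, and a coloring with few colors
  bounds all degrees.
\<close>

lemma frugal_coloring_degree_le:
  fixes c :: "'a \<Rightarrow> nat"
  assumes "pair_graph G" and c: "frugal_coloring t G c" "c ` pverts G \<subseteq> {..<k}"
    and v: "v \<in> pverts G"
  shows "card (neighborhood G v) \<le> (k - 1) * t"
proof -
  interpret pair_graph G by fact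
  let ?C = "\<lambda>a. {u \<in> neighborhood G v. c u = a}"
  have sub: "neighborhood G v \<subseteq> pverts G"
    using in_arcsD2 by (auto simp: neighborhood_def)
  then have fin: "finite (neighborhood G v)"
    using pair_finite_verts by (rule finite_subset)
  have "c u \<noteq> c v" if "u \<in> neighborhood G v" for u
    using that c(1) by (fastforce simp: neighborhood_def frugal_coloring_def)
  then have "neighborhood G v \<subseteq> (\<Union>a \<in> {..<k} - {c v}. ?C a)"
    using sub c(2) by blast
  then have "card (neighborhood G v) \<le> card (\<Union>a \<in> {..<k} - {c v}. ?C a)"
    using fin by (intro card_mono) auto
  also have "\<dots> \<le> (\<Sum>a \<in> {..<k} - {c v}. card (?C a))"
    by (rule card_UN_le) simp
  also have "\<dots> \<le> (\<Sum>a \<in> {..<k} - {c v}. t)"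
    using c(1) v by (intro sum_mono) (auto simp: frugal_coloring_def)
  also have "\<dots> = (k - 1) * t"
    using c(2) v by (auto simp: image_subset_iff)
  finally show ?thesis .
qed

section \<open>Neighbors in a grid\<close>

abbreviation grid :: "nat list \<Rightarrow> nat list pair_pre_digraph" where
  "grid ms \<equiv> cart_prod_list (map path_graph ms)"

definition step_up :: "nat list \<Rightarrow> nat \<Rightarrow> nat list" where
  "step_up xs i = xs[i := Suc (xs ! i)]"

definition step_down :: "nat list \<Rightarrow> nat \<Rightarrow> nat list" where
  "step_down xs i = xs[i := xs ! i - 1]"

lemma pair_graph_grid: "pair_graph (grid ms)"
  by (rule pair_graph_cart_prod_list) (auto simp: pair_graph_path_graph)

lemma pverts_grid:
  "pverts (grid ms) = {xs. length xs = length ms \<and> (\<forall>i < length ms. xs ! i < ms ! i)}"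
  by (auto simp: pverts_cart_prod_list path_graph_def)

lemma neighborhood_grid:
  assumes "xs \<in> pverts (grid ms)"
  shows "neighborhood (grid ms) xs =
    step_up xs ` {i. i < length ms \<and> Suc (xs ! i) < ms ! i} \<union>
    step_down xs ` {i. i < length ms \<and> 0 < xs ! i}" (is "?N = ?U \<union> ?D")
proof
  have len: "length xs = length ms" and bound: "\<And>i. i < length ms \<Longrightarrow> xs ! i < ms ! i"
    using assms by (auto simp: pverts_grid)
  show "?N \<subseteq> ?U \<union> ?D"
  proof
    fix ys assume "ys \<in> ?N"
    then obtain i where ys: "ys \<in> pverts (grid ms)" and i: "i < length ms"
      and step: "ys ! i = Suc (xs ! i) \<or> xs ! i = Suc (ys ! i)"
      and eq: "\<forall>j < length ms. j \<noteq> i \<longrightarrow> xs ! j = ys ! j"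
      by (auto simp: neighborhood_def parcs_cart_prod_list path_graph_def)
    have ys_eq: "ys = xs[i := ys ! i]"
      using ys len eq i by (intro nth_equalityI) (auto simp: pverts_grid nth_list_update)
    have "ys ! i < ms ! i" using ys i by (auto simp: pverts_grid)
    with step show "ys \<in> ?U \<union> ?D"
    proof (elim disjE)
      assume "ys ! i = Suc (xs ! i)"
      then show ?thesis using ys_eq i \<open>ys ! i < ms ! i\<close> by (auto simp: step_up_def)
    next
      assume "xs ! i = Suc (ys ! i)"
      then have "ys = step_down xs i" "0 < xs ! i" using ys_eq by (simp_all add: step_down_def)
      then show ?thesis using i by blast
    qed
  qed
  show "?U \<union> ?D \<subseteq> ?N"
    using len bound
    by (auto simp: neighborhood_def parcs_cart_prod_list pverts_cart_prod_list path_graph_def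
        step_up_def step_down_def nth_list_update less_imp_diff_less)
qed

lemma inj_on_step_up: "inj_on (step_up xs) {..<length xs}"
proof (rule inj_onI)
  fix i j assume "i \<in> {..<length xs}" "j \<in> {..<length xs}" "step_up xs i = step_up xs j"
  then have "step_up xs i ! i = step_up xs j ! i" "i < length xs" by simp_all
  then show "i = j" by (cases "i = j") (simp_all add: step_up_def)
qed

lemma inj_on_step_down: "inj_on (step_down xs) {i. i < length xs \<and> 0 < xs ! i}"
proof (rule inj_onI)
  fix i j assume "i \<in> {i. i < length xs \<and> 0 < xs ! i}" "j \<in> {i. i < length xs \<and> 0 < xs ! i}"
    "step_down xs i = step_down xs j"
  then have "step_down xs i ! i = step_down xs j ! i" "i < length xs" "0 < xs ! i" by simp_all
  then show "i = j" by (cases "i = j") (simp_all add: step_down_def)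
qed

lemma step_up_neq_step_down:
  assumes "i < length xs" "j < length xs" "0 < xs ! j"
  shows "step_up xs i \<noteq> step_down xs j"
proof
  assume "step_up xs i = step_down xs j"
  then have "step_up xs i ! i = step_down xs j ! i" by simp
  then show False
    using assms by (auto simp: step_up_def step_down_def nth_list_update split: if_splits)
qed

lemma card_neighborhood_interior:
  assumes "xs \<in> pverts (grid ms)"
    and interior: "\<And>i. i < length ms \<Longrightarrow> 0 < xs ! i \<and> Suc (xs ! i) < ms ! i"
  shows "card (neighborhood (grid ms) xs) = 2 * length ms"
proof -
  let ?I = "{..<length ms}"
  have len: "length xs = length ms" using assms by (auto simp: pverts_grid)
  have I: "{i. i < length ms \<and> Suc (xs ! i) < ms ! i} = ?I"
    "{i. i < length ms \<and> 0 < xs ! i} = ?I"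
    using interior by auto
  have "inj_on (step_up xs) ?I" "inj_on (step_down xs) ?I"
    using inj_on_step_up[of xs] inj_on_step_down[of xs] I len by simp_all
  moreover have "step_up xs ` ?I \<inter> step_down xs ` ?I = {}"
    using interior len step_up_neq_step_down by fastforce
  ultimately show ?thesis
    unfolding neighborhood_grid[OF assms(1)] I by (simp add: card_Un_disjoint card_image)
qed

section \<open>The linear coloring of a grid\<close>

definition weight :: "nat list \<Rightarrow> nat" where
  "weight xs = (\<Sum>i < length xs. Suc i * xs ! i)"

definition grid_color :: "nat list \<Rightarrow> nat" where
  "grid_color xs = weight xs mod Suc (length xs)"

lemma weight_step_up:
  assumes "i < length xs"
  shows "weight (step_up xs i) = weight xs + Suc i"
proof -
  have "weight (step_up xs i) = (\<Sum>j < length xs. Suc j * xs ! j + (if j = i then Suc i else 0))"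
    unfolding weight_def by (intro sum.cong) (auto simp: step_up_def nth_list_update)
  also have "\<dots> = weight xs + Suc i"
    using assms by (simp add: weight_def sum.distrib del: mult_Suc)
  finally show ?thesis .
qed

lemma weight_step_down:
  assumes "i < length xs" "0 < xs ! i"
  shows "weight (step_down xs i) + Suc i = weight xs"
proof -
  have "step_up (step_down xs i) i = xs"
    using assms by (simp add: step_up_def step_down_def)
  then show ?thesis
    using weight_step_up[of i "step_down xs i"] assms by (simp add: step_down_def)
qed

lemma length_step [simp]: "length (step_up xs i) = length xs" "length (step_down xs i) = length xs"
  by (simp_all add: step_up_def step_down_def)

text \<open>
  Equal colors of two upward neighbors force their coefficients to be congruent, and so do equal
  colors of two downward neighbors; but the coefficients \<open>1, \<dots>, n\<close> are distinct residues modulo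
  \<open>n + 1\<close>.
\<close>

lemma inj_on_grid_color_step_up:
  "inj_on (\<lambda>i. grid_color (step_up xs i)) {..<length xs}"
proof (rule inj_onI)
  fix i j assume ij: "i \<in> {..<length xs}" "j \<in> {..<length xs}"
    and "grid_color (step_up xs i) = grid_color (step_up xs j)"
  then have "[weight xs + Suc i = weight xs + Suc j] (mod Suc (length xs))"
    by (simp add: grid_color_def weight_step_up cong_def)
  then have "[Suc i = Suc j] (mod Suc (length xs))"
    by (simp only: cong_add_lcancel_nat)
  then show "i = j" using ij by (simp add: cong_def)
qed

lemma inj_on_grid_color_step_down:
  "inj_on (\<lambda>i. grid_color (step_down xs i)) {i. i < length xs \<and> 0 < xs ! i}"
proof (rule inj_onI)
  fix i j assume ij: "i \<in> {i. i < length xs \<and> 0 < xs ! i}" "j \<in> {i. i < length xs \<and> 0 < xs ! i}"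
    and eq: "grid_color (step_down xs i) = grid_color (step_down xs j)"
  let ?d = "weight (step_down xs j)"
  have "[weight (step_down xs i) + Suc i = ?d + Suc i] (mod Suc (length xs))"
    using eq by (intro cong_add) (simp_all add: grid_color_def cong_def)
  moreover have "weight (step_down xs i) + Suc i = ?d + Suc j"
    using ij weight_step_down by simp
  ultimately have "[?d + Suc j = ?d + Suc i] (mod Suc (length xs))"
    by simp
  then have "[Suc j = Suc i] (mod Suc (length xs))"
    by (simp only: cong_add_lcancel_nat)
  then show "i = j" using ij by (simp add: cong_def)
qed

lemma weight_add_Suc_not_cong:
  assumes "i < n"
  shows "(w + Suc i) mod Suc n \<noteq> w mod Suc n"
proof
  assume "(w + Suc i) mod Suc n = w mod Suc n"
  then have "[w + Suc i = w + 0] (mod Suc n)" by (simp add: cong_def)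
  then have "[Suc i = 0] (mod Suc n)" by (simp only: cong_add_lcancel_nat)
  then show False using assms by (simp add: cong_def)
qed

lemma grid_color_step_neq:
  assumes "i < length xs"
  shows "grid_color (step_up xs i) \<noteq> grid_color xs"
    and "0 < xs ! i \<Longrightarrow> grid_color (step_down xs i) \<noteq> grid_color xs"
  using weight_add_Suc_not_cong[OF assms] weight_step_up[OF assms] weight_step_down[OF assms]
  by (metis grid_color_def length_step(1), metis grid_color_def length_step(2))

lemma card_fiber_le_1:
  assumes "inj_on (\<lambda>i. c (f i)) A" "finite A"
  shows "card {u \<in> f ` A. c u = a} \<le> 1"
proof -
  have "inj_on c (f ` A)" using assms(1) by (auto simp: inj_on_def)
  then have "\<forall>x \<in> {u \<in> f ` A. c u = a}. \<forall>y \<in> {u \<in> f ` A. c u = a}. x = y"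
    by (auto dest: inj_onD)
  then show ?thesis
    using assms(2) card_le_Suc0_iff_eq[of "{u \<in> f ` A. c u = a}"] by simp
qed

lemma frugal_coloring_grid_color: "frugal_coloring 2 (grid ms) grid_color"
  unfolding frugal_coloring_def
proof (intro conjI ballI allI)
  interpret pair_graph "grid ms" by (rule pair_graph_grid)
  fix e assume e: "e \<in> parcs (grid ms)"
  obtain xs ys where xy: "e = (xs, ys)" by force
  have xs: "xs \<in> pverts (grid ms)" and "ys \<in> neighborhood (grid ms) xs"
    using e xy in_arcsD1 by (auto simp: neighborhood_def)
  moreover have "length xs = length ms" using xs by (simp add: pverts_grid)
  ultimately have "grid_color ys \<noteq> grid_color xs"
    using grid_color_step_neq[of _ xs] unfolding neighborhood_grid[OF xs] by auto
  then show "case e of (u, v) \<Rightarrow> grid_color u \<noteq> grid_color v"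
    using xy by simp
next
  fix xs a assume xs: "xs \<in> pverts (grid ms)"
  let ?U = "{i. i < length ms \<and> Suc (xs ! i) < ms ! i}"
  let ?D = "{i. i < length ms \<and> 0 < xs ! i}"
  have len: "length xs = length ms" using xs by (simp add: pverts_grid)
  have "inj_on (\<lambda>i. grid_color (step_up xs i)) ?U"
    using inj_on_grid_color_step_up by (rule inj_on_subset) (auto simp: len)
  then have U: "card {u \<in> step_up xs ` ?U. grid_color u = a} \<le> 1"
    by (rule card_fiber_le_1) simp
  have "inj_on (\<lambda>i. grid_color (step_down xs i)) ?D"
    using inj_on_grid_color_step_down by (rule inj_on_subset) (auto simp: len)
  then have D: "card {u \<in> step_down xs ` ?D. grid_color u = a} \<le> 1"
    by (rule card_fiber_le_1) simp
  have "{u \<in> neighborhood (grid ms) xs. grid_color u = a} =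
      {u \<in> step_up xs ` ?U. grid_color u = a} \<union> {u \<in> step_down xs ` ?D. grid_color u = a}"
    unfolding neighborhood_grid[OF xs] by blast
  then show "card {u \<in> neighborhood (grid ms) xs. grid_color u = a} \<le> 2"
    using U D card_Un_le[of "{u \<in> step_up xs ` ?U. grid_color u = a}"
        "{u \<in> step_down xs ` ?D. grid_color u = a}"] by simp
qed

lemma grid_color_image: "grid_color ` pverts (grid ms) \<subseteq> {..<Suc (length ms)}"
proof
  fix a assume "a \<in> grid_color ` pverts (grid ms)"
  then obtain xs where "length xs = length ms" "a = grid_color xs"
    by (auto simp: pverts_grid)
  then show "a \<in> {..<Suc (length ms)}"
    using mod_less_divisor[of "Suc (length ms)" "weight xs"] by (simp add: grid_color_def)
qed

section \<open>Maximum degree and frugal chromatic number of a grid\<close>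

context
  fixes ms :: "nat list"
  assumes sides: "\<And>i. i < length ms \<Longrightarrow> ms ! i \<ge> 3"
begin

lemma interior_vertex:
  obtains xs where "xs \<in> pverts (grid ms)" "card (neighborhood (grid ms) xs) = 2 * length ms"
proof
  let ?xs = "replicate (length ms) (1 :: nat)"
  show "?xs \<in> pverts (grid ms)"
    using sides by (force simp: pverts_grid)
  then show "card (neighborhood (grid ms) ?xs) = 2 * length ms"
    by (rule card_neighborhood_interior) (use sides in force)
qed

lemma max_degree_grid: "max_degree (grid ms) = 2 * length ms"
  unfolding max_degree_def
proof (rule Max_eqI)
  interpret pair_graph "grid ms" by (rule pair_graph_grid)
  show "finite (out_degree (with_proj (grid ms)) ` pverts (grid ms))"
    using pair_finite_verts by simp
  show "d \<le> 2 * length ms" if "d \<in> out_degree (with_proj (grid ms)) ` pverts (grid ms)" for d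
    using that frugal_coloring_degree_le[OF pair_graph_grid frugal_coloring_grid_color
        grid_color_image]
    by (auto simp: out_degree_eq_card_neighborhood mult.commute)
  show "2 * length ms \<in> out_degree (with_proj (grid ms)) ` pverts (grid ms)"
    using interior_vertex by (metis out_degree_eq_card_neighborhood imageI)
qed

lemma frugal_chromatic_number_grid: "frugal_chromatic_number 2 (grid ms) = Suc (length ms)"
  unfolding frugal_chromatic_number_def
proof (rule Least_equality)
  show "\<exists>c :: nat list \<Rightarrow> nat. frugal_coloring 2 (grid ms) c \<and>
      c ` pverts (grid ms) \<subseteq> {..<Suc (length ms)}"
    using frugal_coloring_grid_color grid_color_image by blast
next
  fix k assume "\<exists>c :: nat list \<Rightarrow> nat. frugal_coloring 2 (grid ms) c \<and>
      c ` pverts (grid ms) \<subseteq> {..<k}"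
  then obtain c :: "nat list \<Rightarrow> nat" where c: "frugal_coloring 2 (grid ms) c"
    "c ` pverts (grid ms) \<subseteq> {..<k}"
    by blast
  obtain xs where xs: "xs \<in> pverts (grid ms)"
    "card (neighborhood (grid ms) xs) = 2 * length ms"
    by (rule interior_vertex)
  have "2 * length ms \<le> (k - 1) * 2"
    using frugal_coloring_degree_le[OF pair_graph_grid c xs(1)] xs(2) by simp
  moreover have "0 < k" using c(2) xs(1) by auto
  ultimately show "Suc (length ms) \<le> k" by simp
qed

end

theorem corollary6p8:
  fixes n :: nat and m :: "nat \<Rightarrow> nat" and G :: "nat list pair_pre_digraph"
  assumes "n \<ge> 1"
    and "\<forall>i \<in> {1..n}. m i \<ge> 3"
    and "G = cart_prod_list (map (\<lambda>i. path_graph (m i)) [1..<Suc n])"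
  shows "int (frugal_chromatic_number 2 G) = \<lceil>real (max_degree G) / 2\<rceil> + 1"
proof -
  define ms where "ms = map m [1..<Suc n]"
  have G: "G = grid ms" and len: "length ms = n"
    using assms(3) by (simp_all add: ms_def comp_def del: upt_Suc)
  have "ms ! i \<ge> 3" if "i < length ms" for i
    using that assms(2) len by (simp add: ms_def del: upt_Suc)
  then show ?thesis
    using max_degree_grid[of ms] frugal_chromatic_number_grid[of ms] by (simp add: G len)
qed

end
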